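(* Let $\varepsilon>0$ and $c(x,y)=|x-y|^2$. Let $X\subseteq\mathbb{R}$ be the closure of a bounded open set with $\mathrm{diam}(X)>\sqrt{2\varepsilon}$. Then the map $(\mu,\dot\mu)\mapsto\mathbf{g}_\mu(\dot\mu,\dot\mu)$ is not jointly convex on $\mathcal{P}(X)\times C^1(X)^*_0$.
   Context: $\mathcal{P}(X)$: Borel probability measures on $X$. $C^1(X)$ has norm $\max(\|\phi\|_\infty,\|\phi'\|_\infty)$, and $C^1(X)^*_0=\{\nu\in C^1(X)^*:\langle\nu,1_X\rangle=0\}$. For $\mu\in\mathcal{P}(X)$, $f_{\mu,\mu}\in C(X)$ is the unique function with $\int_X\exp\left(\frac1\varepsilon(f_{\mu,\mu}(x)+f_{\mu,\mu}(y)-c(x,y))\right)d\mu(x)=1$ for all $y\in X$; $k_\mu(x,y)=\exp\left(\frac1\varepsilon(f_{\mu,\mu}(x)+f_{\mu,\mu}(y)-c(x,y))\right)$; $K_\mu[\phi](y)=\int_X\phi(x)k_\mu(x,y)\,d\mu(x)$; for $\nu\in C^1(X)^*$, $H_\mu[\nu](y)=\langle\nu,k_\mu(\cdot,y)\rangle$. $K_\mu$ fixes constants and $\mathrm{id}-K_\mu^2$ is boundedly invertible on $C^1(X)/\mathbb{R}$ (quotient by constants). The metric tensor is, for $\dot\mu\in C^1(X)^*_0$, $$\mathbf{g}_\mu(\dot\mu,\dot\mu)=\frac\varepsilon2\langle\dot\mu,(\mathrm{id}-K_\mu^2)^{-1}H_\mu[\dot\mu]\rangle .$$ *)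

theory Defs
  imports "HOL-Probability.Probability"
begin

text \<open>
  \<open>C\<^sup>1(X)\<close> for a set \<open>X\<close> that is the closure of its interior: continuous functions on \<open>X\<close> that are
  differentiable in the interior, with a derivative extending continuously to \<open>X\<close>. Functions on
  \<open>X\<close> are total functions on the reals of which only the values on \<open>X\<close> matter. As the
  interior is dense in \<open>X\<close>, the extended derivative has the same supremum as the derivative on
  the interior.
\<close>

definition C1_fun :: "real set \<Rightarrow> (real \<Rightarrow> real) set" where
  "C1_fun X = {\<phi>. continuous_on X \<phi> \<and>
     (\<exists>\<phi>'. continuous_on X \<phi>' \<and> (\<forall>x\<in>interior X. (\<phi> has_real_derivative \<phi>' x) (at x)))}"

definition C1_norm :: "real set \<Rightarrow> (real \<Rightarrow> real) \<Rightarrow> real" where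
  "C1_norm X \<phi> = max (SUP x\<in>X. \<bar>\<phi> x\<bar>) (SUP x\<in>interior X. \<bar>deriv \<phi> x\<bar>)"

text \<open>
  Functionals are considered only through their values on \<open>C1_fun X\<close>. By linearity and
  boundedness they take equal values on functions that agree on \<open>X\<close>.
\<close>

definition C1_dual :: "real set \<Rightarrow> ((real \<Rightarrow> real) \<Rightarrow> real) set" where
  "C1_dual X = {\<nu>.
     (\<forall>\<phi>\<in>C1_fun X. \<forall>\<psi>\<in>C1_fun X. \<nu> (\<lambda>x. \<phi> x + \<psi> x) = \<nu> \<phi> + \<nu> \<psi>) \<and>
     (\<forall>a. \<forall>\<phi>\<in>C1_fun X. \<nu> (\<lambda>x. a * \<phi> x) = a * \<nu> \<phi>) \<and>
     (\<exists>B. \<forall>\<phi>\<in>C1_fun X. \<bar>\<nu> \<phi>\<bar> \<le> B * C1_norm X \<phi>)}"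

definition C1_dual0 :: "real set \<Rightarrow> ((real \<Rightarrow> real) \<Rightarrow> real) set" where
  "C1_dual0 X = {\<nu> \<in> C1_dual X. \<nu> (\<lambda>x. 1) = 0}"

text \<open>The quotient \<open>C\<^sup>1(X)/\<real>\<close>; its elements are equivalence classes.\<close>

definition const_rel :: "real set \<Rightarrow> ((real \<Rightarrow> real) \<times> (real \<Rightarrow> real)) set" where
  "const_rel X = {(\<phi>, \<psi>). \<phi> \<in> C1_fun X \<and> \<psi> \<in> C1_fun X \<and> (\<exists>a. \<forall>x\<in>X. \<phi> x = \<psi> x + a)}"

definition C1_mod_const :: "real set \<Rightarrow> (real \<Rightarrow> real) set set" where
  "C1_mod_const X = C1_fun X // const_rel X"

definition class_of :: "real set \<Rightarrow> (real \<Rightarrow> real) \<Rightarrow> (real \<Rightarrow> real) set" where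
  "class_of X \<phi> = const_rel X `` {\<phi>}"

text \<open>The pairing of \<open>C1_dual0 X\<close> with \<open>C1_mod_const X\<close>: \<open>\<nu>\<close> is constant on each class.\<close>

definition quot_pairing :: "((real \<Rightarrow> real) \<Rightarrow> real) \<Rightarrow> (real \<Rightarrow> real) set \<Rightarrow> real" where
  "quot_pairing \<nu> \<Phi> = the_elem (\<nu> ` \<Phi>)"

definition prob_measures :: "real set \<Rightarrow> real measure set" where
  "prob_measures X = {\<mu>. prob_space \<mu> \<and> sets \<mu> = sets (restrict_space borel X)}"

text \<open>The potential \<open>f\<^sub>\<mu>\<^sub>,\<^sub>\<mu>\<close>; extensionality makes it unique as a total function.\<close>

definition potential ::
    "real \<Rightarrow> (real \<Rightarrow> real \<Rightarrow> real) \<Rightarrow> real set \<Rightarrow> real measure \<Rightarrow> real \<Rightarrow> real" where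
  "potential \<epsilon> c X \<mu> = (THE f. f \<in> extensional X \<and> continuous_on X f \<and>
     (\<forall>y\<in>X. (\<integral>x. exp (1 / \<epsilon> * (f x + f y - c x y)) \<partial>\<mu>) = 1))"

definition kernel ::
    "real \<Rightarrow> (real \<Rightarrow> real \<Rightarrow> real) \<Rightarrow> real set \<Rightarrow> real measure \<Rightarrow> real \<Rightarrow> real \<Rightarrow> real" where
  "kernel \<epsilon> c X \<mu> x y = exp (1 / \<epsilon> * (potential \<epsilon> c X \<mu> x + potential \<epsilon> c X \<mu> y - c x y))"

definition K_op ::
    "real \<Rightarrow> (real \<Rightarrow> real \<Rightarrow> real) \<Rightarrow> real set \<Rightarrow> real measure \<Rightarrow> (real \<Rightarrow> real) \<Rightarrow> real \<Rightarrow> real" where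
  "K_op \<epsilon> c X \<mu> \<phi> y = (\<integral>x. \<phi> x * kernel \<epsilon> c X \<mu> x y \<partial>\<mu>)"

definition H_op ::
    "real \<Rightarrow> (real \<Rightarrow> real \<Rightarrow> real) \<Rightarrow> real set \<Rightarrow> real measure \<Rightarrow>
     ((real \<Rightarrow> real) \<Rightarrow> real) \<Rightarrow> real \<Rightarrow> real" where
  "H_op \<epsilon> c X \<mu> \<nu> y = \<nu> (\<lambda>x. kernel \<epsilon> c X \<mu> x y)"

text \<open>
  The operator \<open>id - K\<^sub>\<mu>\<^sup>2\<close> induced on the quotient. Since \<open>K\<^sub>\<mu>\<close> fixes constants, the classes in the
  union coincide.
\<close>

definition id_minus_K2 ::
    "real \<Rightarrow> (real \<Rightarrow> real \<Rightarrow> real) \<Rightarrow> real set \<Rightarrow> real measure \<Rightarrow>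
     (real \<Rightarrow> real) set \<Rightarrow> (real \<Rightarrow> real) set" where
  "id_minus_K2 \<epsilon> c X \<mu> \<Phi> =
     (\<Union>\<phi>\<in>\<Phi>. class_of X (\<lambda>y. \<phi> y - K_op \<epsilon> c X \<mu> (K_op \<epsilon> c X \<mu> \<phi>) y))"

definition metric_tensor ::
    "real \<Rightarrow> (real \<Rightarrow> real \<Rightarrow> real) \<Rightarrow> real set \<Rightarrow> real measure \<Rightarrow>
     ((real \<Rightarrow> real) \<Rightarrow> real) \<Rightarrow> real" where
  "metric_tensor \<epsilon> c X \<mu> \<nu> = \<epsilon> / 2 *
     quot_pairing \<nu>
       (inv_into (C1_mod_const X) (id_minus_K2 \<epsilon> c X \<mu>) (class_of X (H_op \<epsilon> c X \<mu> \<nu>)))"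

text \<open>The convex combination \<open>(1 - t) \<mu>\<^sub>0 + t \<mu>\<^sub>1\<close> of measures on the same \<open>\<sigma>\<close>-algebra.\<close>

definition measure_mix :: "real \<Rightarrow> 'a measure \<Rightarrow> 'a measure \<Rightarrow> 'a measure" where
  "measure_mix t \<mu>0 \<mu>1 = measure_of (space \<mu>0) (sets \<mu>0)
     (\<lambda>A. ennreal (1 - t) * emeasure \<mu>0 A + ennreal t * emeasure \<mu>1 A)"

definition jointly_convex ::
    "'a measure set \<Rightarrow> ('b \<Rightarrow> real) set \<Rightarrow> ('a measure \<Rightarrow> ('b \<Rightarrow> real) \<Rightarrow> real) \<Rightarrow> bool" where
  "jointly_convex P D g \<longleftrightarrow>
     (\<forall>\<mu>0\<in>P. \<forall>\<mu>1\<in>P. \<forall>\<nu>0\<in>D. \<forall>\<nu>1\<in>D. \<forall>t\<in>{0..1}.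
        g (measure_mix t \<mu>0 \<mu>1) (\<lambda>\<phi>. (1 - t) * \<nu>0 \<phi> + t * \<nu>1 \<phi>)
          \<le> (1 - t) * g \<mu>0 \<nu>0 + t * g \<mu>1 \<nu>1)"

end

theory Submission
  imports Defs
begin

text \<open>
  Already on three points \<open>a\<close>, \<open>a + d\<close>, \<open>a + 2d\<close> of \<open>U\<close> convexity fails. For \<open>\<mu> = p\<delta>\<^sub>a + q\<delta>\<^sub>a\<^sub>+\<^sub>d\<close> the
  kernel \<open>k\<^sub>\<mu>\<close> is explicit in terms of the ratio \<open>r\<close> of the two coefficients in
  \<open>exp (- f\<^sub>\<mu>\<^sub>,\<^sub>\<mu> / \<epsilon>)\<close>, and \<open>(id - K\<^sub>\<mu>\<^sup>2)\<^sup>-\<^sup>1\<close> reduces to division by \<open>1 - \<lambda>\<^sup>2\<close> for a scalar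
  \<open>\<lambda>\<close>. Start at \<open>(\<delta>\<^sub>a, \<delta>\<^sub>a\<^sub>+\<^sub>d - \<delta>\<^sub>a)\<close> and move along
  the segment on which, as \<open>q\<close> grows, the coefficients of the functional at the three points change by
  \<open>q (2 - E, E - 3, 1)\<close>, where \<open>E = exp (2 d\<^sup>2 / \<epsilon>)\<close>. The direction is chosen to make the
  coefficient of \<open>q\<^sup>2\<close> in the metric tensor small: up to the factor \<open>\<epsilon> / 2\<close> it is
  \<open>- E (E - 1)\<^sup>3 < 0\<close>.
\<close>

section \<open>Continuously differentiable functions on X and the quotient by constants\<close>

lemma C1_fun_cong:
  assumes "\<phi> \<in> C1_fun X" and "\<And>x. x \<in> X \<Longrightarrow> \<phi> x = \<psi> x"
  shows "\<psi> \<in> C1_fun X"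
proof -
  obtain \<phi>' where \<phi>': "continuous_on X \<phi>'"
      "\<And>x. x \<in> interior X \<Longrightarrow> (\<phi> has_real_derivative \<phi>' x) (at x)"
    using assms(1) by (auto simp: C1_fun_def)
  \<comment> \<open>Differentiability is local, so at an interior point only values on the open set
    \<open>interior X\<close> count.\<close>
  have "(\<psi> has_real_derivative \<phi>' x) (at x)" if "x \<in> interior X" for x
    using \<phi>'(2)[OF that] open_interior that
    by (rule has_field_derivative_transform_within_open) (use assms(2) interior_subset in auto)
  moreover have "continuous_on X \<psi>"
    using assms continuous_on_cong[of X X \<phi> \<psi>] by (auto simp: C1_fun_def)
  ultimately show ?thesis using \<phi>'(1) by (auto simp: C1_fun_def)
qed

lemma C1_funI:
  assumes "\<And>x. (\<phi> has_real_derivative \<phi>' x) (at x)" and "continuous_on UNIV \<phi>'"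
  shows "\<phi> \<in> C1_fun X"
proof -
  have "continuous_on X \<phi>"
    using assms(1) by (meson DERIV_isCont continuous_at_imp_continuous_on)
  then show ?thesis
    using assms continuous_on_subset[OF assms(2)] by (auto simp: C1_fun_def)
qed

lemma C1_fun_const: "(\<lambda>x. a) \<in> C1_fun X"
  by (rule C1_funI[where \<phi>' = "\<lambda>x. 0"]) auto

lemma C1_fun_add:
  assumes "\<phi> \<in> C1_fun X" and "\<psi> \<in> C1_fun X"
  shows "(\<lambda>x. \<phi> x + \<psi> x) \<in> C1_fun X"
proof -
  obtain \<phi>' \<psi>' where d: "continuous_on X \<phi>'" "continuous_on X \<psi>'"
      "\<And>x. x \<in> interior X \<Longrightarrow> (\<phi> has_real_derivative \<phi>' x) (at x)"
      "\<And>x. x \<in> interior X \<Longrightarrow> (\<psi> has_real_derivative \<psi>' x) (at x)"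
    using assms by (auto simp: C1_fun_def)
  have "continuous_on X (\<lambda>x. \<phi>' x + \<psi>' x)"
    using d by (intro continuous_intros)
  moreover have "\<And>x. x \<in> interior X \<Longrightarrow> ((\<lambda>x. \<phi> x + \<psi> x) has_real_derivative \<phi>' x + \<psi>' x) (at x)"
    using d by (auto intro!: derivative_intros)
  moreover have "continuous_on X (\<lambda>x. \<phi> x + \<psi> x)"
    using assms by (auto simp: C1_fun_def intro!: continuous_intros)
  ultimately show ?thesis unfolding C1_fun_def by blast
qed

lemma C1_fun_cmult:
  assumes "\<phi> \<in> C1_fun X"
  shows "(\<lambda>x. a * \<phi> x) \<in> C1_fun X"
proof -
  obtain \<phi>' where d: "continuous_on X \<phi>'"
      "\<And>x. x \<in> interior X \<Longrightarrow> (\<phi> has_real_derivative \<phi>' x) (at x)"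
    using assms by (auto simp: C1_fun_def)
  have "continuous_on X (\<lambda>x. a * \<phi>' x)"
    using d by (intro continuous_intros)
  moreover have "\<And>x. x \<in> interior X \<Longrightarrow> ((\<lambda>x. a * \<phi> x) has_real_derivative a * \<phi>' x) (at x)"
    using d by (auto intro!: derivative_eq_intros)
  moreover have "continuous_on X (\<lambda>x. a * \<phi> x)"
    using assms by (auto simp: C1_fun_def intro!: continuous_intros)
  ultimately show ?thesis unfolding C1_fun_def by blast
qed

lemma equiv_const_rel: "equiv (C1_fun X) (const_rel X)"
proof (rule equivI)
  show "const_rel X \<subseteq> C1_fun X \<times> C1_fun X"
    by (auto simp: const_rel_def)
  show "refl_on (C1_fun X) (const_rel X)"
    by (auto simp: refl_on_def const_rel_def intro!: exI[of _ 0])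
  have "\<exists>b. \<forall>x\<in>X. \<psi> x = \<phi> x + b" if "\<forall>x\<in>X. \<phi> x = \<psi> x + a" for \<phi> \<psi> :: "real \<Rightarrow> real" and a
    using that by (intro exI[of _ "-a"]) simp
  then show "sym (const_rel X)"
    by (auto simp: sym_def const_rel_def)
  have "\<exists>e. \<forall>x\<in>X. \<phi> x = \<theta> x + e"
    if "\<forall>x\<in>X. \<phi> x = \<psi> x + a" "\<forall>x\<in>X. \<psi> x = \<theta> x + b" for \<phi> \<psi> \<theta> :: "real \<Rightarrow> real" and a b
    using that by (intro exI[of _ "b + a"]) simp
  then show "trans (const_rel X)"
    by (auto simp: trans_def const_rel_def)
qed

lemma class_of_eq_iff:
  assumes "\<phi> \<in> C1_fun X" and "\<psi> \<in> C1_fun X"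
  shows "class_of X \<phi> = class_of X \<psi> \<longleftrightarrow> (\<exists>a. \<forall>x\<in>X. \<phi> x = \<psi> x + a)"
  using eq_equiv_class_iff[OF equiv_const_rel assms] assms
  by (simp add: class_of_def const_rel_def)

lemma mem_class_of: "\<psi> \<in> class_of X \<phi> \<longleftrightarrow> (\<phi>, \<psi>) \<in> const_rel X"
  by (simp add: class_of_def)

text \<open>Compactness keeps the supremum over \<open>X\<close> finite, so it really bounds each
  value. This makes point evaluations bounded functionals.\<close>

lemma abs_le_C1_norm:
  assumes "compact X" and "\<phi> \<in> C1_fun X" and "x \<in> X"
  shows "\<bar>\<phi> x\<bar> \<le> C1_norm X \<phi>"
proof -
  have "continuous_on X (\<lambda>x. \<bar>\<phi> x\<bar>)"
    using assms(2) by (auto simp: C1_fun_def intro!: continuous_intros)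
  then have "bdd_above ((\<lambda>x. \<bar>\<phi> x\<bar>) ` X)"
    by (intro bounded_imp_bdd_above compact_imp_bounded compact_continuous_image assms(1))
  then have "\<bar>\<phi> x\<bar> \<le> (SUP x\<in>X. \<bar>\<phi> x\<bar>)"
    using assms(3) by (rule cSUP_upper2) simp
  then show ?thesis by (simp add: C1_norm_def)
qed

text \<open>The equations identify \<open>1 - s * t\<close> with both
  \<open>\<alpha> * s * (s - t)\<close> and \<open>(1 - \<beta>) * t * (t - s)\<close>, whose signs
  conflict unless \<open>s = t\<close>. With \<open>s\<close> and \<open>t\<close> the quotients of
  two candidate scalings at the atoms, this yields uniqueness of the potential.\<close>

lemma symmetric_scaling_unique:
  fixes s t \<alpha> \<beta> :: real
  assumes "s > 0" "t > 0" "0 < \<alpha>" "\<alpha> \<le> 1" "0 \<le> \<beta>" "\<beta> \<le> 1"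
    and 1: "s * (\<alpha> * s + (1 - \<alpha>) * t) = 1"
    and 2: "t * (\<beta> * s + (1 - \<beta>) * t) = 1"
  shows "s = 1 \<and> t = 1"
proof -
  have 3: "\<alpha> * s * (s - t) = 1 - s * t"
    using 1 by (simp add: algebra_simps)
  have 4: "\<beta> * t * (s - t) = 1 - t * t"
    using 2 by (simp add: algebra_simps)
  have 5: "(1 - \<beta>) * t * (t - s) = 1 - s * t"
    using 2 by (simp add: algebra_simps)
  have pos: "\<alpha> * s > 0" using assms by simp
  have "s = t"
  proof (rule linorder_cases)
    assume "s < t"
    then have "\<alpha> * s * (s - t) < 0" "(1 - \<beta>) * t * (t - s) \<ge> 0"
      using assms pos by (auto intro!: mult_pos_neg mult_nonneg_nonneg)
    then show ?thesis using 3 5 by simp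
  next
    assume "t < s"
    then have "\<alpha> * s * (s - t) > 0" "(1 - \<beta>) * t * (t - s) \<le> 0"
      using assms pos by (auto intro!: mult_pos_pos mult_nonneg_nonpos)
    then show ?thesis using 3 5 by simp
  qed
  then have "t * t = 1" using 4 by simp
  then show ?thesis using \<open>s = t\<close> assms(2) by (auto simp: square_eq_1_iff)
qed

section \<open>Expansions f(r) = a + b r + c r^2 + o(r^2) as r -> 0+\<close>

definition second_order :: "(real \<Rightarrow> real) \<Rightarrow> real \<Rightarrow> real \<Rightarrow> real \<Rightarrow> bool" where
  "second_order f a b c \<longleftrightarrow> ((\<lambda>r. (f r - a - b * r) / r\<^sup>2) \<longlongrightarrow> c) (at_right 0)"

text \<open>An exact remainder factor \<open>g\<close> collects everything beyond the linear term,
  and its limit is the second coefficient. The rules below thus reduce to algebraic identities and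
  limits.\<close>

lemma second_orderI:
  assumes "(g \<longlongrightarrow> c) (at_right 0)" and "\<And>r. r > 0 \<Longrightarrow> f r = a + b * r + r\<^sup>2 * g r"
  shows "second_order f a b c"
  unfolding second_order_def
proof (rule Lim_transform_eventually[OF assms(1)])
  show "\<forall>\<^sub>F r in at_right 0. g r = (f r - a - b * r) / r\<^sup>2"
    using eventually_at_right_less[of 0] by eventually_elim (simp add: assms(2))
qed

lemma second_orderD:
  assumes "second_order f a b c"
  shows "\<exists>g. (g \<longlongrightarrow> c) (at_right 0) \<and> (\<forall>r>0. f r = a + b * r + r\<^sup>2 * g r)"
  using assms by (intro exI[of _ "\<lambda>r. (f r - a - b * r) / r\<^sup>2"]) (auto simp: second_order_def)

lemma second_order_quadratic: "second_order (\<lambda>r. a + b * r + c * r\<^sup>2) a b c"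
  by (rule second_orderI[where g = "\<lambda>r. c"]) auto

lemma second_order_const: "second_order (\<lambda>r. a) a 0 0"
  using second_order_quadratic[of a 0 0] by simp

lemma second_order_add:
  assumes "second_order f a b c" and "second_order g a' b' c'"
  shows "second_order (\<lambda>r. f r + g r) (a + a') (b + b') (c + c')"
proof -
  obtain u where u: "(u \<longlongrightarrow> c) (at_right 0)" "\<And>r. r > 0 \<Longrightarrow> f r = a + b * r + r\<^sup>2 * u r"
    using second_orderD[OF assms(1)] by blast
  obtain v where v: "(v \<longlongrightarrow> c') (at_right 0)" "\<And>r. r > 0 \<Longrightarrow> g r = a' + b' * r + r\<^sup>2 * v r"
    using second_orderD[OF assms(2)] by blast
  show ?thesis
    by (rule second_orderI[OF tendsto_add[OF u(1) v(1)]]) (simp add: u(2) v(2) algebra_simps)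
qed

lemma second_order_mult:
  assumes "second_order f a b c" and "second_order g a' b' c'"
  shows "second_order (\<lambda>r. f r * g r) (a * a') (a * b' + b * a') (a * c' + b * b' + c * a')"
proof -
  obtain u where u: "(u \<longlongrightarrow> c) (at_right 0)" "\<And>r. r > 0 \<Longrightarrow> f r = a + b * r + r\<^sup>2 * u r"
    using second_orderD[OF assms(1)] by blast
  obtain v where v: "(v \<longlongrightarrow> c') (at_right 0)" "\<And>r. r > 0 \<Longrightarrow> g r = a' + b' * r + r\<^sup>2 * v r"
    using second_orderD[OF assms(2)] by blast
  have "((\<lambda>r. (a + b * r) * v r + b * b' + u r * (a' + b' * r + r\<^sup>2 * v r))
      \<longlongrightarrow> (a + b * 0) * c' + b * b' + c * (a' + b' * 0 + 0\<^sup>2 * c')) (at_right 0)"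
    by (intro tendsto_intros u(1) v(1))
  then show ?thesis
    by (intro second_orderI[where g = "\<lambda>r. (a + b * r) * v r + b * b' + u r * (a' + b' * r + r\<^sup>2 * v r)"])
      (simp_all add: u(2) v(2) algebra_simps power2_eq_square)
qed

text \<open>From (1 + p r + q r^2) (1 - p r) = 1 - r^2 (p^2 - q + p q r), which gives the remainder
  exactly. The signs of \<open>p\<close> and \<open>q\<close> keep the denominator positive.\<close>

lemma second_order_inverse_quadratic:
  assumes "p \<ge> 0" "q \<ge> 0"
  shows "second_order (\<lambda>r. inverse (1 + p * r + q * r\<^sup>2)) 1 (- p) (p\<^sup>2 - q)"
proof (rule second_orderI)
  have "((\<lambda>r. (p\<^sup>2 - q + p * q * r) / (1 + p * r + q * r\<^sup>2))
      \<longlongrightarrow> (p\<^sup>2 - q + p * q * 0) / (1 + p * 0 + q * 0\<^sup>2)) (at_right 0)"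
    by (intro tendsto_intros) simp
  then show "((\<lambda>r. (p\<^sup>2 - q + p * q * r) / (1 + p * r + q * r\<^sup>2)) \<longlongrightarrow> p\<^sup>2 - q) (at_right 0)"
    by simp
  show "inverse (1 + p * r + q * r\<^sup>2) = 1 + - p * r + r\<^sup>2 * ((p\<^sup>2 - q + p * q * r) / (1 + p * r + q * r\<^sup>2))"
    if "r > 0" for r
  proof -
    have "1 + p * r + q * r\<^sup>2 > 0" using assms that by (simp add: add_pos_nonneg)
    then show ?thesis by (simp add: field_simps power2_eq_square)
  qed
qed

text \<open>For the far endpoint of the segment, which has parameter \<open>2 * r\<close>.\<close>

lemma second_order_double:
  assumes "second_order f a b c"
  shows "second_order (\<lambda>r. f (2 * r)) a (2 * b) (4 * c)"
proof -
  obtain u where u: "(u \<longlongrightarrow> c) (at_right 0)" "\<And>r. r > 0 \<Longrightarrow> f r = a + b * r + r\<^sup>2 * u r"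
    using second_orderD[OF assms] by blast
  have "filterlim (\<lambda>r. 2 * r :: real) (at_right 0) (at_right 0)"
    by (intro filterlim_at_withinI tendsto_eq_intros refl) (auto simp: eventually_at_filter)
  then have "((\<lambda>r. 4 * u (2 * r)) \<longlongrightarrow> 4 * c) (at_right 0)"
    by (intro tendsto_intros filterlim_compose[OF u(1)])
  then show ?thesis
    by (rule second_orderI) (simp add: u(2) algebra_simps power2_eq_square)
qed

lemma second_order_eqI:
  assumes "second_order f a b c"
    and "\<And>r. r > 0 \<Longrightarrow> f r = g r" "a = a'" "b = b'" "c = c'"
  shows "second_order g a' b' c'"
proof -
  obtain u where u: "(u \<longlongrightarrow> c) (at_right 0)" "\<And>r. r > 0 \<Longrightarrow> f r = a + b * r + r\<^sup>2 * u r"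
    using second_orderD[OF assms(1)] by blast
  then show ?thesis
    using assms(2-5) by (intro second_orderI[of u]) auto
qed

section \<open>The explicit kernel of a two-point measure\<close>

locale three_points =
  fixes \<epsilon> a d :: real and X :: "real set"
  assumes eps_pos: "\<epsilon> > 0" and d_pos: "d > 0" and compact_X: "compact X"
    and pts: "a \<in> X" "a + d \<in> X" "a + 2 * d \<in> X"
begin

definition sq_cost :: "real \<Rightarrow> real \<Rightarrow> real" where
  "sq_cost = (\<lambda>x y. \<bar>x - y\<bar>\<^sup>2)"

text \<open>A push-forward of a Bernoulli law: for \<open>q\<close> in the unit interval,
  \<open>a + d\<close> gets mass \<open>q\<close>. The target \<sigma>-algebra is the one required
  by \<open>prob_measures\<close>.\<close>

definition dirac_mix :: "real \<Rightarrow> real measure" where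
  "dirac_mix q = distr (measure_pmf (bernoulli_pmf q)) (restrict_space borel X)
     (\<lambda>b. if b then a + d else a)"

definition eval3 :: "real \<Rightarrow> real \<Rightarrow> real \<Rightarrow> (real \<Rightarrow> real) \<Rightarrow> real" where
  "eval3 n0 n1 n2 \<phi> = n0 * \<phi> a + n1 * \<phi> (a + d) + n2 * \<phi> (a + 2 * d)"

text \<open>At the points \<open>a + j * d\<close> and \<open>a + k * d\<close> the function
  \<open>gram\<close> equals \<open>E ^ (j * k)\<close>, so all its entries are powers of this
  number.\<close>

definition E :: real where
  "E = exp (2 * d\<^sup>2 / \<epsilon>)"

text \<open>What remains of exp(-c(x,y)/\<epsilon>) when the factors depending on \<open>x\<close>
  or \<open>y\<close> alone are split off by expanding the square around \<open>a\<close>.\<close>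

definition gram :: "real \<Rightarrow> real \<Rightarrow> real" where
  "gram x y = exp (2 * ((x - a) * (y - a)) / \<epsilon>)"

text \<open>Up to a constant and a Gaussian factor this is exp(-f/\<epsilon>) for the potential f.
  The atom \<open>a\<close> contributes the summand 1, since \<open>gram a x = 1\<close>.\<close>

definition den :: "real \<Rightarrow> real \<Rightarrow> real" where
  "den r x = 1 + r * gram (a + d) x"

text \<open>The quadratic form of the matrix \<open>gram\<close> on the two atoms at the vector (1,
  r). It equals \<open>den r a + r * den r (a + d)\<close> and normalises the masses.\<close>

definition scal :: "real \<Rightarrow> real" where
  "scal r = 1 + 2 * r + E * r\<^sup>2"

text \<open>The mass of \<open>a + d\<close> as a rational function of the ratio \<open>r\<close>.
  Recovering \<open>r\<close> from the mass would mean solving a quadratic equation.\<close>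

definition weight :: "real \<Rightarrow> real" where
  "weight r = r * (1 + E * r) / scal r"

definition ker :: "real \<Rightarrow> real \<Rightarrow> real \<Rightarrow> real" where
  "ker r x y = scal r * gram x y / (den r x * den r y)"

definition pot :: "real \<Rightarrow> real \<Rightarrow> real" where
  "pot r = restrict (\<lambda>x. (x - a)\<^sup>2 + \<epsilon> * (ln (scal r) / 2 - ln (den r x))) X"

lemma E_gt_1: "E > 1"
  using eps_pos d_pos by (simp add: E_def)

lemma gram_pos: "gram x y > 0"
  by (simp add: gram_def)

lemma gram_commute: "gram x y = gram y x"
  by (metis gram_def mult.commute)

lemma gram_a [simp]: "gram a y = 1" "gram x a = 1"
  by (simp_all add: gram_def)

lemma E_power: "E ^ n = exp (real n * (2 * d\<^sup>2 / \<epsilon>))"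
  by (simp only: E_def exp_of_nat_mult)

lemma gram_values [simp]:
  "gram (a + d) (a + d) = E"
  "gram (a + d) (a + 2 * d) = E\<^sup>2" "gram (a + 2 * d) (a + d) = E\<^sup>2"
  "gram (a + 2 * d) (a + 2 * d) = E ^ 4"
  by (simp add: gram_def E_def power2_eq_square)
    (simp_all add: gram_def E_power, simp_all add: power2_eq_square mult_ac)

lemma den_pos: "r \<ge> 0 \<Longrightarrow> den r x > 0"
  using gram_pos[of "a + d" x] by (simp add: den_def add_pos_nonneg)

lemma den_a [simp]: "den r a = 1 + r"
  and den_ad [simp]: "den r (a + d) = 1 + r * E"
  and den_a2d [simp]: "den r (a + 2 * d) = 1 + r * E\<^sup>2"
  by (simp_all add: den_def)

lemma scal_pos: "r \<ge> 0 \<Longrightarrow> scal r > 0"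
  using E_gt_1 by (simp add: scal_def add_pos_nonneg)

lemma one_minus_weight:
  assumes "r \<ge> 0"
  shows "1 - weight r = (1 + r) / scal r"
  using scal_pos[OF assms] by (simp add: weight_def scal_def field_simps power2_eq_square)

lemma weight_bounds:
  assumes "r \<ge> 0"
  shows "0 \<le> weight r" "weight r < 1"
proof -
  show "0 \<le> weight r"
    using assms scal_pos[OF assms] E_gt_1 by (simp add: weight_def)
  have "(1 + r) / scal r > 0"
    using assms scal_pos[OF assms] by simp
  then show "weight r < 1" using one_minus_weight[OF assms] by simp
qed

lemma ker_pos: "r \<ge> 0 \<Longrightarrow> ker r x y > 0"
  by (simp add: ker_def scal_pos den_pos gram_pos)

lemma ker_commute: "ker r x y = ker r y x"
  by (simp add: ker_def gram_commute mult_ac)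

text \<open>The atoms contribute \<open>1 / den r y\<close> and
  \<open>r * gram (a + d) y / den r y\<close>, whose numerators add up to \<open>den r y\<close>.
  This is the equation defining the potential, also at points without mass.\<close>

lemma ker_balance:
  assumes "r \<ge> 0"
  shows "(1 - weight r) * ker r a y + weight r * ker r (a + d) y = 1"
proof -
  have pos: "scal r > 0" "den r y > 0" "1 + r > 0" "1 + r * E > 0"
    using assms scal_pos den_pos[of r] den_pos[of r "a + d"] by auto
  have "(1 - weight r) * ker r a y = 1 / den r y"
    using pos by (simp add: one_minus_weight[OF assms] ker_def)
  moreover have "weight r * ker r (a + d) y = r * gram (a + d) y / den r y"
    using pos by (simp add: weight_def ker_def mult.commute)
  moreover have "1 / den r y + r * gram (a + d) y / den r y = 1"
    using pos(2) by (simp add: den_def add_divide_distrib[symmetric])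
  ultimately show ?thesis by simp
qed

lemma ker_C1_fun:
  assumes "r \<ge> 0"
  shows "ker r x \<in> C1_fun X"
proof -
  \<comment> \<open>The derivative in \<open>y\<close> by the quotient rule.\<close>
  define g' where "g' y = scal r * (2 / \<epsilon> * (x - a) * gram x y * (den r x * den r y)
     - gram x y * (den r x * (r * (2 / \<epsilon> * d * gram (a + d) y)))) / (den r x * den r y)\<^sup>2" for y
  have nz: "den r z \<noteq> 0" for z
    using den_pos[OF assms, of z] by simp
  have gram': "(gram z has_real_derivative 2 / \<epsilon> * (z - a) * gram z y) (at y)" for z y
    unfolding gram_def using eps_pos by (auto intro!: derivative_eq_intros)
  have den': "(den r has_real_derivative r * (2 / \<epsilon> * d * gram (a + d) y)) (at y)" for y
    unfolding den_def by (auto intro!: derivative_eq_intros gram')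
  have cont: "continuous_on UNIV (gram z)" "continuous_on UNIV (den r)" for z
    using gram' den' by (meson DERIV_isCont continuous_at_imp_continuous_on)+
  have "(ker r x has_real_derivative g' y) (at y)" for y
    unfolding ker_def g'_def
    by (rule derivative_eq_intros refl gram' den' | simp add: nz power2_eq_square algebra_simps)+
  moreover have "continuous_on UNIV g'"
    unfolding g'_def by (intro continuous_intros cont) (simp add: nz)
  ultimately show ?thesis by (rule C1_funI)
qed

section \<open>Integrals and mixtures of two-point measures\<close>

lemma sets_dirac_mix [simp]: "sets (dirac_mix q) = sets (restrict_space borel X)"
  by (simp add: dirac_mix_def)

lemma space_dirac_mix [simp]: "space (dirac_mix q) = X"
  by (simp add: dirac_mix_def space_restrict_space)

lemma pick_measurable:
  "(\<lambda>b. if b then a + d else a) \<in> measurable (measure_pmf P) (restrict_space borel X)"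
  using pts by (simp add: measurable_pmf_measure1 Pi_iff space_restrict_space)

lemma dirac_mix_prob: "dirac_mix q \<in> prob_measures X"
  unfolding prob_measures_def
  using prob_space.prob_space_distr[OF prob_space_measure_pmf pick_measurable]
  by (simp add: dirac_mix_def)

lemma integral_dirac_mix:
  fixes f :: "real \<Rightarrow> real"
  assumes "0 \<le> q" "q \<le> 1" and "f \<in> borel_measurable (restrict_space borel X)"
  shows "(\<integral>x. f x \<partial>dirac_mix q) = (1 - q) * f a + q * f (a + d)"
  unfolding dirac_mix_def
  using assms integral_bernoulli_pmf[OF assms(1,2)] by (subst integral_distr[OF pick_measurable]) (auto simp: mult_ac)

text \<open>The kernel is known to agree with the continuous function \<open>ker\<close> only on
  \<open>X\<close>, so measurability of the integrand is taken over from a continuous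
  \<open>g\<close> that coincides with it there.\<close>

lemma integral_dirac_mix_continuous:
  fixes f g :: "real \<Rightarrow> real"
  assumes "0 \<le> q" "q \<le> 1" and "continuous_on X g" and "\<And>x. x \<in> X \<Longrightarrow> f x = g x"
  shows "(\<integral>x. f x \<partial>dirac_mix q) = (1 - q) * f a + q * f (a + d)"
proof (rule integral_dirac_mix[OF assms(1,2)])
  have "g \<in> borel_measurable (restrict_space borel X)"
    using assms(3) by (rule borel_measurable_continuous_on_restrict)
  then show "f \<in> borel_measurable (restrict_space borel X)"
    by (subst measurable_cong[where g = g]) (auto simp: space_restrict_space assms(4))
qed

lemma emeasure_dirac_mix:
  assumes "0 \<le> q" "q \<le> 1" and "A \<in> sets (restrict_space borel X)"
  shows "emeasure (dirac_mix q) A = ennreal ((1 - q) * indicator A a + q * indicator A (a + d))"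
proof -
  interpret prob_space "dirac_mix q"
    using dirac_mix_prob[of q] by (simp add: prob_measures_def)
  have "measure (dirac_mix q) A = (\<integral>x. indicator A x \<partial>dirac_mix q)"
    using assms(3) sets.sets_into_space[OF assms(3)]
    by (simp add: Int_absorb2 space_restrict_space)
  also have "\<dots> = (1 - q) * indicator A a + q * indicator A (a + d)"
    using assms by (intro integral_dirac_mix) auto
  finally show ?thesis by (simp add: emeasure_eq_measure)
qed

lemma measure_mix_dirac_mix:
  assumes "0 \<le> q0" "q0 \<le> 1" "0 \<le> q1" "q1 \<le> 1" "0 \<le> t" "t \<le> 1"
  shows "measure_mix t (dirac_mix q0) (dirac_mix q1) = dirac_mix ((1 - t) * q0 + t * q1)"
    (is "_ = dirac_mix ?q")
proof -
  have q: "0 \<le> ?q" "?q \<le> 1"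
    using assms convex_bound_le[of q0 1 q1 "1 - t" t] by auto
  have "measure_mix t (dirac_mix q0) (dirac_mix q1)
      = measure_of (space (dirac_mix ?q)) (sets (dirac_mix ?q)) (emeasure (dirac_mix ?q))"
    unfolding measure_mix_def sets_dirac_mix space_dirac_mix
  proof (rule measure_of_eq)
    show "sets (restrict_space borel X) \<subseteq> Pow X"
      using sets.space_closed[of "restrict_space borel X"] by (simp add: space_restrict_space)
    fix A assume "A \<in> sigma_sets X (sets (restrict_space borel X))"
    then have A: "A \<in> sets (restrict_space borel X)"
      using sets.sigma_sets_eq[of "restrict_space borel X"] by (simp add: space_restrict_space)
    \<comment> \<open>The measure of \<open>A\<close> is affine in \<open>q\<close>, so mixing the
      measures amounts to mixing their parameters.\<close>
    define u where "u q = (1 - q) * indicator A a + q * indicator A (a + d)" for q :: real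
    have "u q0 \<ge> 0" "u q1 \<ge> 0"
      using assms by (auto simp: u_def indicator_def)
    then have "ennreal (1 - t) * ennreal (u q0) + ennreal t * ennreal (u q1)
        = ennreal ((1 - t) * u q0 + t * u q1)"
      using assms by (simp add: ennreal_mult ennreal_plus)
    also have "(1 - t) * u q0 + t * u q1 = u ?q"
      by (simp add: u_def algebra_simps)
    finally show "ennreal (1 - t) * emeasure (dirac_mix q0) A + ennreal t * emeasure (dirac_mix q1) A
        = emeasure (dirac_mix ?q) A"
      using assms q A by (simp add: emeasure_dirac_mix u_def)
  qed
  then show ?thesis by (simp only: measure_of_of_measure)
qed

section \<open>The potential and the kernel in closed form\<close>

lemma scaled_exp_eq_ker:
  assumes "r \<ge> 0" "x \<in> X" "y \<in> X"
  shows "exp (1 / \<epsilon> * (pot r x + pot r y - sq_cost x y)) = ker r x y"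
proof -
  have *: "1 / \<epsilon> * (pot r x + pot r y - sq_cost x y)
      = ln (scal r) + 2 * ((x - a) * (y - a)) / \<epsilon> - (ln (den r x) + ln (den r y))"
    using assms eps_pos by (simp add: pot_def sq_cost_def field_simps power2_eq_square)
  show ?thesis
    unfolding * using scal_pos[OF assms(1)] den_pos[OF assms(1)]
    by (simp add: exp_add exp_diff ker_def gram_def)
qed

lemma pot_continuous:
  assumes "r \<ge> 0"
  shows "continuous_on X (pot r)"
proof -
  have "continuous_on X (\<lambda>x. (x - a)\<^sup>2 + \<epsilon> * (ln (scal r) / 2 - ln (den r x)))"
    using den_pos[OF assms, unfolded den_def gram_def]
    unfolding den_def gram_def using eps_pos by (intro continuous_intros) (auto simp: less_imp_neq[symmetric])
  then show ?thesis
    unfolding pot_def by (subst continuous_on_cong[OF refl]) auto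
qed

lemma potential_integral:
  assumes "r \<ge> 0" "continuous_on X g" "y \<in> X"
  shows "(\<integral>x. exp (1 / \<epsilon> * (g x + g y - sq_cost x y)) \<partial>dirac_mix (weight r))
    = (1 - weight r) * exp (1 / \<epsilon> * (g a + g y - sq_cost a y))
      + weight r * exp (1 / \<epsilon> * (g (a + d) + g y - sq_cost (a + d) y))"
proof (rule integral_dirac_mix_continuous[OF _ _ _ refl])
  show "0 \<le> weight r" "weight r \<le> 1" using weight_bounds[OF assms(1)] by auto
  show "continuous_on X (\<lambda>x. exp (1 / \<epsilon> * (g x + g y - sq_cost x y)))"
    unfolding sq_cost_def by (intro continuous_intros assms)
qed

lemma potential_dirac_mix:
  assumes r: "r \<ge> 0"
  shows "potential \<epsilon> sq_cost X (dirac_mix (weight r)) = pot r"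
  unfolding potential_def
proof (rule the_equality, intro conjI ballI)
  show "pot r \<in> extensional X" by (simp add: pot_def)
  show "continuous_on X (pot r)" by (rule pot_continuous[OF r])
  fix y assume "y \<in> X"
  then show "(\<integral>x. exp (1 / \<epsilon> * (pot r x + pot r y - sq_cost x y)) \<partial>dirac_mix (weight r)) = 1"
    using pts r ker_balance[OF r, of y]
    by (simp add: potential_integral pot_continuous scaled_exp_eq_ker del: times_divide_eq_left)
next
  fix g assume g: "g \<in> extensional X \<and> continuous_on X g \<and>
    (\<forall>y\<in>X. (\<integral>x. exp (1 / \<epsilon> * (g x + g y - sq_cost x y)) \<partial>dirac_mix (weight r)) = 1)"
  \<comment> \<open>The quotient of the two scalings. With \<open>\<alpha> y\<close> the share of
    the atom \<open>a\<close> in the balance at \<open>y\<close>, the equation for \<open>g\<close>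
    says that \<open>s y\<close> times a convex combination of \<open>s a\<close> and
    \<open>s (a + d)\<close> is 1. At the atoms this forces both values to be 1, and then
    \<open>s y = 1\<close> on all of \<open>X\<close>.\<close>
  define s where "s x = exp ((g x - pot r x) / \<epsilon>)" for x
  define \<alpha> where "\<alpha> y = (1 - weight r) * ker r a y" for y
  have s_ker: "exp (1 / \<epsilon> * (g x + g y - sq_cost x y)) = s x * s y * ker r x y"
    if "x \<in> X" "y \<in> X" for x y
    using that eps_pos r
    by (simp add: s_def scaled_exp_eq_ker[symmetric] field_simps flip: exp_add)
  have s_eq: "s y * (\<alpha> y * s a + (1 - \<alpha> y) * s (a + d)) = 1" if "y \<in> X" for y
  proof -
    have "(1 - weight r) * (s a * s y * ker r a y)
        + weight r * (s (a + d) * s y * ker r (a + d) y) = 1"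
      using g that pts potential_integral[OF r, of g y] by (simp add: s_ker del: times_divide_eq_left)
    moreover have "weight r * ker r (a + d) y = 1 - \<alpha> y"
      using ker_balance[OF r, of y] by (simp add: \<alpha>_def)
    then have "weight r * (s (a + d) * s y * ker r (a + d) y) = (1 - \<alpha> y) * (s (a + d) * s y)"
      by (metis mult.assoc mult.commute)
    ultimately show ?thesis by (simp add: \<alpha>_def algebra_simps)
  qed
  have \<alpha>: "0 < \<alpha> y" "\<alpha> y \<le> 1" for y
  proof -
    show "0 < \<alpha> y" using weight_bounds[OF r] ker_pos[OF r] by (simp add: \<alpha>_def)
    have "0 \<le> weight r * ker r (a + d) y"
      using weight_bounds[OF r] ker_pos[OF r, of "a + d" y] by simp
    then show "\<alpha> y \<le> 1" using ker_balance[OF r, of y] by (simp add: \<alpha>_def)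
  qed
  have "s a = 1 \<and> s (a + d) = 1"
    using s_eq[OF pts(1)] s_eq[OF pts(2)] \<alpha>(1)[of a] \<alpha>(2)[of a] \<alpha>(1)[of "a + d"] \<alpha>(2)[of "a + d"]
    by (intro symmetric_scaling_unique[of _ _ "\<alpha> a" "\<alpha> (a + d)"]) (auto simp: s_def)
  then have "s y = 1" if "y \<in> X" for y
    using s_eq[OF that] by simp
  then have "g y = pot r y" if "y \<in> X" for y
    using that eps_pos by (simp add: s_def)
  then show "g = pot r"
    using g by (intro extensionalityI[of _ X]) (auto simp: pot_def)
qed

lemma kernel_dirac_mix:
  assumes "r \<ge> 0" "x \<in> X" "y \<in> X"
  shows "kernel \<epsilon> sq_cost X (dirac_mix (weight r)) x y = ker r x y"
  using assms by (simp only: kernel_def potential_dirac_mix scaled_exp_eq_ker)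

section \<open>The metric tensor on three-point functionals\<close>

lemma eval3_C1_dual0:
  assumes "n0 + n1 + n2 = 0"
  shows "eval3 n0 n1 n2 \<in> C1_dual0 X"
proof -
  have "\<bar>eval3 n0 n1 n2 \<phi>\<bar> \<le> (\<bar>n0\<bar> + \<bar>n1\<bar> + \<bar>n2\<bar>) * C1_norm X \<phi>" if "\<phi> \<in> C1_fun X" for \<phi>
  proof -
    note le = abs_le_C1_norm[OF compact_X that]
    have "\<bar>eval3 n0 n1 n2 \<phi>\<bar> \<le> \<bar>n0\<bar> * \<bar>\<phi> a\<bar> + \<bar>n1\<bar> * \<bar>\<phi> (a + d)\<bar> + \<bar>n2\<bar> * \<bar>\<phi> (a + 2 * d)\<bar>"
      unfolding eval3_def abs_mult[symmetric] by linarith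
    also have "\<dots> \<le> \<bar>n0\<bar> * C1_norm X \<phi> + \<bar>n1\<bar> * C1_norm X \<phi> + \<bar>n2\<bar> * C1_norm X \<phi>"
      by (intro add_mono mult_left_mono le pts) auto
    finally show ?thesis by (simp add: algebra_simps)
  qed
  then show ?thesis
    using assms unfolding C1_dual0_def C1_dual_def
    by (auto simp: eval3_def algebra_simps intro!: exI[of _ "\<bar>n0\<bar> + \<bar>n1\<bar> + \<bar>n2\<bar>"])
qed

text \<open>This is 2/\<epsilon> times the metric tensor. Up to \<open>scal r\<close>, the terms
  before the fraction pair the functional with its image under \<open>H_op\<close>, and the fraction
  comes from (id - K^2)^{-1} - id.\<close>

definition value3 :: "real \<Rightarrow> real \<Rightarrow> real \<Rightarrow> real \<Rightarrow> real" where
  "value3 r n0 n1 n2 = (let x0 = n0 / (1 + r); x1 = n1 / (1 + r * E); x2 = n2 / (1 + r * E\<^sup>2) in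
     scal r * (x0\<^sup>2 + E * x1\<^sup>2 + E ^ 4 * x2\<^sup>2 + 2 * x0 * x1 + 2 * x0 * x2 + 2 * E\<^sup>2 * x1 * x2
       + (E - 1) * (x0 + x1 + x2)\<^sup>2 / (1 + 2 * E * r + E * r\<^sup>2)))"

text \<open>The factor by which \<open>K r\<close> multiplies the difference of the values at
  \<open>a\<close> and \<open>a + d\<close>. As \<open>K r\<close> has rank at most one modulo
  constants, no other eigenvalue on the quotient can be nonzero.\<close>

definition lam :: "real \<Rightarrow> real" where
  "lam r = 1 - ker r a (a + d)"

lemma lam_eq:
  assumes "r \<ge> 0"
  shows "lam r = r * (E - 1) / ((1 + r) * (1 + r * E))"
proof -
  have "(1 + r) * (1 + r * E) > 0"
    using assms E_gt_1 by (intro mult_pos_pos) (auto simp: add_pos_nonneg)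
  then show ?thesis
    unfolding lam_def ker_def scal_def by (simp add: field_simps power2_eq_square)
qed

lemma one_minus_lam_sq:
  assumes "r \<ge> 0"
  shows "1 - (lam r)\<^sup>2 = scal r * (1 + 2 * E * r + E * r\<^sup>2) / ((1 + r) * (1 + r * E))\<^sup>2"
proof -
  define P where "P = (1 + r) * (1 + r * E)"
  have P: "P > 0"
    unfolding P_def using assms E_gt_1 by (intro mult_pos_pos) (auto simp: add_pos_nonneg)
  have "1 - (lam r)\<^sup>2 = (P\<^sup>2 - (r * (E - 1))\<^sup>2) / P\<^sup>2"
    using P by (simp add: lam_eq[OF assms] P_def[symmetric] power_divide diff_divide_distrib)
  \<comment> \<open>A difference of squares: \<open>P - r * (E - 1)\<close> is
    \<open>scal r\<close>, and \<open>P + r * (E - 1)\<close> is the other factor.\<close>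
  also have "P\<^sup>2 - (r * (E - 1))\<^sup>2 = scal r * (1 + 2 * E * r + E * r\<^sup>2)"
    by (simp add: P_def scal_def power2_eq_square algebra_simps)
  finally show ?thesis by (simp add: P_def)
qed

lemma one_minus_lam_sq_pos:
  assumes "r \<ge> 0"
  shows "1 - (lam r)\<^sup>2 > 0"
proof -
  have "1 + r > 0" "1 + r * E > 0" "1 + 2 * E * r + E * r\<^sup>2 > 0"
    using assms E_gt_1 by (auto simp: add_pos_nonneg)
  then show ?thesis
    unfolding one_minus_lam_sq[OF assms] using scal_pos[OF assms]
    by (intro divide_pos_pos mult_pos_pos zero_less_power)
qed

lemma ker_combination_diff:
  assumes "r \<ge> 0"
  shows "(1 - weight r) * (ker r a a - ker r a (a + d)) = lam r"
  using ker_balance[OF assms, of a] by (simp add: lam_def ker_commute algebra_simps)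

abbreviation K :: "real \<Rightarrow> (real \<Rightarrow> real) \<Rightarrow> real \<Rightarrow> real" where
  "K r \<equiv> K_op \<epsilon> sq_cost X (dirac_mix (weight r))"

text \<open>The balance eliminates the kernel at \<open>a + d\<close>. Modulo constants, the range
  of \<open>K r\<close> is therefore spanned by \<open>ker r a\<close>.\<close>

lemma K_eq:
  assumes "r \<ge> 0" "\<phi> \<in> C1_fun X" "y \<in> X"
  shows "K r \<phi> y = \<phi> (a + d) + (1 - weight r) * (\<phi> a - \<phi> (a + d)) * ker r a y"
proof -
  have "continuous_on X (ker r y)" "continuous_on X \<phi>"
    using ker_C1_fun[OF assms(1), of y] assms(2) by (auto simp: C1_fun_def)
  then have "continuous_on X (\<lambda>x. \<phi> x * ker r y x)"
    by (intro continuous_intros)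
  then have "K r \<phi> y = (1 - weight r) * (\<phi> a * ker r a y) + weight r * (\<phi> (a + d) * ker r (a + d) y)"
    unfolding K_op_def
    using weight_bounds[OF assms(1)] assms pts
    by (subst integral_dirac_mix_continuous[where g = "\<lambda>x. \<phi> x * ker r y x"])
      (auto simp: kernel_dirac_mix ker_commute)
  also have "weight r * (\<phi> (a + d) * ker r (a + d) y) = \<phi> (a + d) * (1 - (1 - weight r) * ker r a y)"
  proof -
    have "weight r * ker r (a + d) y = 1 - (1 - weight r) * ker r a y"
      using ker_balance[OF assms(1), of y] by simp
    then show ?thesis by (metis mult.left_commute)
  qed
  finally show ?thesis by (simp add: algebra_simps)
qed

lemma K_C1_fun:
  assumes "r \<ge> 0" "\<phi> \<in> C1_fun X"
  shows "K r \<phi> \<in> C1_fun X"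
proof (rule C1_fun_cong)
  show "(\<lambda>y. \<phi> (a + d) + (1 - weight r) * (\<phi> a - \<phi> (a + d)) * ker r a y) \<in> C1_fun X"
    by (intro C1_fun_add C1_fun_const C1_fun_cmult ker_C1_fun assms)
qed (simp add: K_eq assms)

lemma K2_eq:
  assumes "r \<ge> 0" "\<phi> \<in> C1_fun X" "y \<in> X"
  shows "K r (K r \<phi>) y = K r \<phi> (a + d) + (1 - weight r) * lam r * (\<phi> a - \<phi> (a + d)) * ker r a y"
proof -
  have "K r \<phi> a - K r \<phi> (a + d)
      = (\<phi> a - \<phi> (a + d)) * ((1 - weight r) * (ker r a a - ker r a (a + d)))"
    using assms pts by (simp add: K_eq algebra_simps)
  then have "K r \<phi> a - K r \<phi> (a + d) = lam r * (\<phi> a - \<phi> (a + d))"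
    by (simp add: ker_combination_diff[OF assms(1)])
  then show ?thesis
    using K_eq[OF assms(1) K_C1_fun[OF assms(1,2)] assms(3)] by simp
qed

definition id_K2 :: "real \<Rightarrow> (real \<Rightarrow> real) \<Rightarrow> real \<Rightarrow> real" where
  "id_K2 r \<phi> = (\<lambda>y. \<phi> y - K r (K r \<phi>) y)"

lemma id_K2_C1_fun:
  assumes "r \<ge> 0" "\<phi> \<in> C1_fun X"
  shows "id_K2 r \<phi> \<in> C1_fun X"
  using C1_fun_add[OF assms(2) C1_fun_cmult[OF K_C1_fun[OF assms(1) K_C1_fun[OF assms]], of "-1"]]
  by (simp add: id_K2_def)

text \<open>Adding a constant to \<open>\<phi>\<close> adds the same constant to its image under
  K^2, so all classes in the union coincide, and \<open>\<phi>\<close> itself makes the union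
  nonempty.\<close>

lemma id_minus_K2_class_of:
  assumes "r \<ge> 0" "\<phi> \<in> C1_fun X"
  shows "id_minus_K2 \<epsilon> sq_cost X (dirac_mix (weight r)) (class_of X \<phi>) = class_of X (id_K2 r \<phi>)"
proof -
  have "class_of X (id_K2 r \<psi>) = class_of X (id_K2 r \<phi>)" if mem: "\<psi> \<in> class_of X \<phi>" for \<psi>
  proof -
    obtain b where \<psi>: "\<psi> \<in> C1_fun X" and b: "\<forall>x\<in>X. \<phi> x = \<psi> x + b"
      using mem by (auto simp: mem_class_of const_rel_def)
    have "\<forall>y\<in>X. id_K2 r \<psi> y = id_K2 r \<phi> y + 0"
      using b pts assms \<psi> by (auto simp: id_K2_def K2_eq K_eq)
    then show ?thesis
      using class_of_eq_iff[OF id_K2_C1_fun id_K2_C1_fun] assms \<psi> by blast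
  qed
  moreover have "\<phi> \<in> class_of X \<phi>"
    using assms(2) by (auto simp: mem_class_of const_rel_def intro!: exI[of _ 0])
  ultimately show ?thesis
    unfolding id_minus_K2_def id_K2_def[symmetric] by blast
qed

lemma H_op_eq:
  assumes "r \<ge> 0" "y \<in> X"
  shows "H_op \<epsilon> sq_cost X (dirac_mix (weight r)) (eval3 n0 n1 n2) y = eval3 n0 n1 n2 (ker r y)"
  using assms pts by (simp add: H_op_def eval3_def kernel_dirac_mix ker_commute)

text \<open>The left side pairs the functional with \<open>h\<close> plus a multiple of
  \<open>ker r a\<close>, the solution of the equation for id - K^2 modulo constants. The functional
  sends \<open>ker r a\<close> to \<open>h a\<close>.\<close>

lemma value3_eq:
  assumes r: "r \<ge> 0" and n: "n0 + n1 + n2 = 0"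
  defines "h \<equiv> \<lambda>y. eval3 n0 n1 n2 (ker r y)"
  shows "eval3 n0 n1 n2 h + lam r * (1 - weight r) * (h a - h (a + d)) / (1 - (lam r)\<^sup>2) * h a
    = value3 r n0 n1 n2"
proof -
  define d0 d1 d2 where d_defs: "d0 = 1 + r" "d1 = 1 + r * E" "d2 = 1 + r * E\<^sup>2"
  define x0 x1 x2 where x_defs: "x0 = n0 / d0" "x1 = n1 / d1" "x2 = n2 / d2"
  define S Q where S_def: "S = scal r" and Q_def: "Q = 1 + 2 * E * r + E * r\<^sup>2"
  define \<sigma> \<tau> where "\<sigma> = x0 + x1 + x2" and "\<tau> = x0 + E * x1 + E\<^sup>2 * x2"
  have pos: "d0 > 0" "d1 > 0" "d2 > 0" "S > 0" "Q > 0"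
    using r E_gt_1 scal_pos[OF r] by (auto simp: d_defs S_def Q_def add_pos_nonneg)
  have nx: "n0 = d0 * x0" "n1 = d1 * x1" "n2 = d2 * x2"
    using pos by (auto simp: x_defs)
  have "eval3 n0 n1 n2 h = S * (x0\<^sup>2 + E * x1\<^sup>2 + E ^ 4 * x2\<^sup>2 + 2 * x0 * x1 + 2 * x0 * x2 + 2 * E\<^sup>2 * x1 * x2)"
    using pos unfolding h_def eval3_def ker_def gram_values gram_a den_a den_ad den_a2d
      S_def[symmetric] d_defs[symmetric] nx
    by (simp add: field_simps power2_eq_square)
  have ha: "h a = S * \<sigma> / d0"
    using pos unfolding h_def eval3_def ker_def gram_values gram_a den_a den_ad den_a2d
      S_def[symmetric] d_defs[symmetric] nx \<sigma>_def
    by (simp add: field_simps)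
  have hb: "h (a + d) = S * \<tau> / d1"
    using pos unfolding h_def eval3_def ker_def gram_values gram_a den_a den_ad den_a2d
      S_def[symmetric] d_defs[symmetric] nx \<tau>_def
    by (simp add: field_simps)
  \<comment> \<open>Total mass zero in the rescaled coordinates: \<open>n0 + n1 + n2\<close> equals
    \<open>\<sigma> + r * \<tau>\<close>.\<close>
  have rel: "\<sigma> = - r * \<tau>"
    using n unfolding nx by (simp add: d_defs \<sigma>_def \<tau>_def algebra_simps)
  have S_eq: "r * d1 + d0 = S"
    by (simp add: d_defs S_def scal_def algebra_simps power2_eq_square)
  \<comment> \<open>The factor \<open>r\<close> is borrowed from \<open>lam r\<close>, so nothing is
    divided by \<open>r\<close> and \<open>r = 0\<close> is covered.\<close>
  have "r * (h a - h (a + d)) = S * \<sigma> * (r * d1 + d0) / (d0 * d1)"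
    using pos unfolding ha hb rel by (simp add: field_simps)
  then have diff: "r * (h a - h (a + d)) = S\<^sup>2 * \<sigma> / (d0 * d1)"
    by (simp add: S_eq power2_eq_square)
  have "lam r * (1 - weight r) * (h a - h (a + d)) / (1 - (lam r)\<^sup>2) * h a
      = (E - 1) * d0 / (d0 * d1 * S) * (r * (h a - h (a + d))) / (S * Q / (d0 * d1)\<^sup>2) * h a"
    unfolding one_minus_lam_sq[OF r] unfolding lam_eq[OF r] one_minus_weight[OF r]
      S_def[symmetric] Q_def[symmetric] d_defs[symmetric] by (simp add: mult_ac)
  also have "\<dots> = S * ((E - 1) * \<sigma>\<^sup>2 / Q)"
    using pos unfolding diff unfolding ha by (simp add: field_simps power2_eq_square)
  finally show ?thesis
    using \<open>eval3 n0 n1 n2 h = _\<close>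
    by (simp add: value3_def Let_def d_defs x_defs S_def Q_def \<sigma>_def algebra_simps)
qed

text \<open>As \<open>inv_into\<close> selects some preimage, the proof first exhibits one and then
  shows that every preimage has the same pairing with the functional.\<close>

lemma metric_tensor_dirac_mix:
  assumes r: "r \<ge> 0" and n: "n0 + n1 + n2 = 0"
  shows "metric_tensor \<epsilon> sq_cost X (dirac_mix (weight r)) (eval3 n0 n1 n2)
    = \<epsilon> / 2 * value3 r n0 n1 n2"
proof -
  define L where "L = id_minus_K2 \<epsilon> sq_cost X (dirac_mix (weight r))"
  define H where "H = H_op \<epsilon> sq_cost X (dirac_mix (weight r)) (eval3 n0 n1 n2)"
  define h where "h = (\<lambda>y. eval3 n0 n1 n2 (ker r y))"
  define \<kappa> where "\<kappa> = lam r * (1 - weight r) * (h a - h (a + d)) / (1 - (lam r)\<^sup>2)"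
  have H_h: "H y = h y" if "y \<in> X" for y
    using that r by (simp add: H_def h_def H_op_eq)
  have "(\<lambda>y. n0 * ker r a y + n1 * ker r (a + d) y + n2 * ker r (a + 2 * d) y) \<in> C1_fun X"
    by (intro C1_fun_add C1_fun_cmult ker_C1_fun r)
  then have h_C1: "h \<in> C1_fun X"
    by (rule C1_fun_cong) (simp add: h_def eval3_def ker_commute)
  then have H_C1: "H \<in> C1_fun X"
    by (rule C1_fun_cong) (simp add: H_h)
  have nz: "1 - (lam r)\<^sup>2 \<noteq> 0"
    using one_minus_lam_sq_pos[OF r] by simp
  \<comment> \<open>K^2 sends every function to a constant plus a multiple of
    \<open>ker r a\<close>, so a solution must be \<open>h\<close> plus such terms. The constant
    \<open>\<kappa>\<close> is fixed by the self-consistency condition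
    \<open>solves\<close>.\<close>
  define \<phi>\<^sub>0 where "\<phi>\<^sub>0 = (\<lambda>y. h y + \<kappa> * ker r a y)"
  have \<phi>\<^sub>0: "\<phi>\<^sub>0 \<in> C1_fun X"
    unfolding \<phi>\<^sub>0_def by (intro C1_fun_add C1_fun_cmult ker_C1_fun r h_C1)
  have solves: "(1 - weight r) * lam r * (\<phi>\<^sub>0 a - \<phi>\<^sub>0 (a + d)) = \<kappa>"
  proof -
    have "(1 - weight r) * (\<phi>\<^sub>0 a - \<phi>\<^sub>0 (a + d)) = (1 - weight r) * (h a - h (a + d)) + \<kappa> * lam r"
      unfolding ker_combination_diff[OF r, symmetric] by (simp add: \<phi>\<^sub>0_def algebra_simps)
    moreover have "\<kappa> * (1 - (lam r)\<^sup>2) = lam r * ((1 - weight r) * (h a - h (a + d)))"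
      using nz by (simp add: \<kappa>_def)
    ultimately have "lam r * ((1 - weight r) * (\<phi>\<^sub>0 a - \<phi>\<^sub>0 (a + d)))
        = \<kappa> * (1 - (lam r)\<^sup>2) + \<kappa> * (lam r)\<^sup>2"
      by (simp only: distrib_left power2_eq_square mult_ac)
    also have "\<dots> = \<kappa>" by (simp add: algebra_simps)
    finally show ?thesis by (simp only: mult_ac)
  qed
  have "\<forall>y\<in>X. id_K2 r \<phi>\<^sub>0 y = H y + - K r \<phi>\<^sub>0 (a + d)"
    using K2_eq[OF r \<phi>\<^sub>0] by (simp add: id_K2_def solves H_h) (simp add: \<phi>\<^sub>0_def)
  then have "class_of X (id_K2 r \<phi>\<^sub>0) = class_of X H"
    using class_of_eq_iff[OF id_K2_C1_fun[OF r \<phi>\<^sub>0] H_C1] by blast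
  then have "L (class_of X \<phi>\<^sub>0) = class_of X H"
    using id_minus_K2_class_of[OF r \<phi>\<^sub>0] by (simp add: L_def)
  moreover have "class_of X \<phi>\<^sub>0 \<in> C1_mod_const X"
    using \<phi>\<^sub>0 by (auto simp: class_of_def C1_mod_const_def quotientI)
  ultimately have img: "class_of X H \<in> L ` C1_mod_const X"
    by (metis imageI)
  define \<Phi> where "\<Phi> = inv_into (C1_mod_const X) L (class_of X H)"
  have "\<Phi> \<in> C1_mod_const X" "L \<Phi> = class_of X H"
    unfolding \<Phi>_def using inv_into_into[OF img] f_inv_into_f[OF img] by auto
  then obtain \<phi> where \<phi>: "\<phi> \<in> C1_fun X" and \<Phi>: "\<Phi> = class_of X \<phi>"
    by (auto simp: C1_mod_const_def class_of_def elim!: quotientE)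
  have "class_of X (id_K2 r \<phi>) = class_of X H"
    using \<open>L \<Phi> = class_of X H\<close> id_minus_K2_class_of[OF r \<phi>] by (simp add: L_def \<Phi>)
  then obtain b where b: "\<forall>y\<in>X. id_K2 r \<phi> y = H y + b"
    using class_of_eq_iff[OF id_K2_C1_fun[OF r \<phi>] H_C1] by blast
  \<comment> \<open>Conversely, any preimage has this form with an unknown \<open>\<delta>\<close>.
    Comparing its values at \<open>a\<close> and \<open>a + d\<close> yields a scalar equation,
    solvable because \<open>1 - (lam r)\<^sup>2\<close> is nonzero.\<close>
  define c where "c = b + K r \<phi> (a + d)"
  define \<delta> where "\<delta> = \<phi> a - \<phi> (a + d)"
  have \<phi>_eq: "\<phi> y = h y + c + (1 - weight r) * lam r * \<delta> * ker r a y" if "y \<in> X" for y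
    using b that K2_eq[OF r \<phi> that] H_h[OF that]
    by (auto simp: id_K2_def c_def \<delta>_def algebra_simps)
  have "\<delta> = (h a + c + (1 - weight r) * lam r * \<delta> * ker r a a)
      - (h (a + d) + c + (1 - weight r) * lam r * \<delta> * ker r a (a + d))"
    using \<phi>_eq[OF pts(1)] \<phi>_eq[OF pts(2)] \<delta>_def by presburger
  then have "\<delta> = h a - h (a + d) + lam r * \<delta> * ((1 - weight r) * (ker r a a - ker r a (a + d)))"
    by (simp add: algebra_simps)
  then have "\<delta> * (1 - (lam r)\<^sup>2) = h a - h (a + d)"
    unfolding ker_combination_diff[OF r] by (simp add: algebra_simps power2_eq_square)
  then have "\<delta> = (h a - h (a + d)) / (1 - (lam r)\<^sup>2)"
    using nz by (simp add: eq_divide_eq)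
  then have \<kappa>_eq: "(1 - weight r) * lam r * \<delta> = \<kappa>"
    by (simp add: \<kappa>_def)
  have pair: "eval3 n0 n1 n2 \<psi> = value3 r n0 n1 n2" if mem: "\<psi> \<in> \<Phi>" for \<psi>
  proof -
    obtain e where e: "\<forall>x\<in>X. \<phi> x = \<psi> x + e"
      using mem by (auto simp: \<Phi> mem_class_of const_rel_def)
    have \<psi>: "\<psi> y = h y + (c - e) + \<kappa> * ker r a y" if "y \<in> X" for y
      using e that \<phi>_eq[OF that] by (auto simp: \<kappa>_eq)
    have "eval3 n0 n1 n2 \<psi> = eval3 n0 n1 n2 h + (c - e) * (n0 + n1 + n2) + \<kappa> * h a"
      using pts by (simp add: eval3_def \<psi>) (simp add: h_def eval3_def algebra_simps)
    then show ?thesis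
      using value3_eq[OF r n] n by (simp add: h_def \<kappa>_def)
  qed
  have "\<phi> \<in> \<Phi>"
    using \<phi> by (auto simp: \<Phi> mem_class_of const_rel_def intro!: exI[of _ 0])
  then have "eval3 n0 n1 n2 ` \<Phi> = {value3 r n0 n1 n2}"
    using pair by auto
  then have "quot_pairing (eval3 n0 n1 n2) \<Phi> = value3 r n0 n1 n2"
    by (simp add: quot_pairing_def)
  then show ?thesis
    by (simp add: metric_tensor_def \<Phi>_def L_def H_def)
qed

section \<open>Expansion of the metric tensor along the segment\<close>

lemma second_order_weight: "second_order weight 0 1 (E - 2)"
  by (rule second_order_eqI[OF second_order_mult[OF second_order_mult[OF
          second_order_quadratic[of 0 1 0] second_order_quadratic[of 1 E 0]]
        second_order_inverse_quadratic[of 2 E]]])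
    (use E_gt_1 in \<open>auto simp: weight_def scal_def divide_inverse\<close>)

lemma second_order_weight_ratio:
  "second_order (\<lambda>r. weight r / weight (2 * r)) (1 / 2) (1 - E / 2) (E\<^sup>2 + E / 2 - 2)"
proof -
  have E: "2 * E \<ge> 0" "E \<ge> 0" using E_gt_1 by auto
  note mult = second_order_mult
  \<comment> \<open>The common factor \<open>r\<close> of the two weights cancels, leaving factors
    covered by the expansion rules.\<close>
  have "1 / 2 * (1 + E * r + 0 * r\<^sup>2) * (1 + 4 * r + 4 * E * r\<^sup>2)
      * inverse (1 + 2 * E * r + 0 * r\<^sup>2) * inverse (1 + 2 * r + E * r\<^sup>2) = weight r / weight (2 * r)"
    if r: "r > 0" for r
  proof -
    have "1 + 2 * E * r > 0" "1 + 2 * r + E * r\<^sup>2 > 0" "1 + 4 * r + 4 * E * r\<^sup>2 > 0"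
      using r E_gt_1 by (auto intro!: add_pos_pos)
    then show ?thesis
      using r by (simp add: weight_def scal_def divide_simps)
  qed
  then show ?thesis
    by (rule second_order_eqI[OF mult[OF mult[OF mult[OF mult[OF second_order_const
            second_order_quadratic] second_order_quadratic]
          second_order_inverse_quadratic[OF E(1) order_refl]]
        second_order_inverse_quadratic[OF zero_le_numeral E(2)]]])
      (simp_all add: field_simps power2_eq_square)
qed

lemma second_order_value3:
  "second_order (\<lambda>r. value3 r (weight r * (2 - E) - 1) (1 + weight r * (E - 3)) (weight r))
    (E - 1) (2 - 4 * E + 2 * E\<^sup>2) (5 * E ^ 3 - 4 + 11 * E - 11 * E\<^sup>2 - E ^ 4)"
proof -
  note const = second_order_const and add = second_order_add and mult = second_order_mult
  define x0 where "x0 r = (weight r * (2 - E) - 1) / (1 + r)" for r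
  define x1 where "x1 r = (1 + weight r * (E - 3)) / (1 + r * E)" for r
  define x2 where "x2 r = weight r / (1 + r * E\<^sup>2)" for r
  define \<sigma> where "\<sigma> r = x0 r + x1 r + x2 r" for r
  define Q where "Q r = inverse (1 + 2 * E * r + E * r\<^sup>2)" for r
  have E: "E \<ge> 0" "E\<^sup>2 \<ge> 0" using E_gt_1 by auto
  note inv = second_order_inverse_quadratic[OF _ order_refl]
  have x0: "second_order x0 (- 1) (3 - E) (5 * E - 7 - E\<^sup>2)"
    by (rule second_order_eqI[OF mult[OF add[OF mult[OF second_order_weight const[of "2 - E"]]
            const[of "- 1"]] inv[of 1]]])
      (simp_all add: x0_def divide_inverse algebra_simps power2_eq_square)
  have x1: "second_order x1 1 (- 3) (6 - 2 * E + E\<^sup>2)"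
    by (rule second_order_eqI[OF mult[OF add[OF const[of 1]
            mult[OF second_order_weight const[of "E - 3"]]] inv[of E]]])
      (use E in \<open>simp_all add: x1_def divide_inverse algebra_simps power2_eq_square\<close>)
  have x2: "second_order x2 0 1 (E - 2 - E\<^sup>2)"
    by (rule second_order_eqI[OF mult[OF second_order_weight inv[of "E\<^sup>2"]]])
      (simp_all add: x2_def divide_inverse mult.commute)
  have \<sigma>: "second_order \<sigma> 0 (1 - E) (4 * E - 3 - E\<^sup>2)"
    by (rule second_order_eqI[OF add[OF add[OF x0 x1] x2]]) (simp_all add: \<sigma>_def)
  \<comment> \<open>As \<open>\<sigma>\<close> has no constant term, its square starts at order two,
    and only the constant term of \<open>Q\<close> affects the product to this order.\<close>
  have \<sigma>\<sigma>: "second_order (\<lambda>r. \<sigma> r * \<sigma> r) 0 0 ((1 - E)\<^sup>2)"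
    by (rule second_order_eqI[OF mult[OF \<sigma> \<sigma>]]) (simp_all add: power2_eq_square)
  have Q: "second_order Q 1 (- 2 * E) ((2 * E)\<^sup>2 - E)"
    using second_order_inverse_quadratic[of "2 * E" E] E by (simp add: Q_def[abs_def])
  define P where "P r = x0 r * x0 r + E * (x1 r * x1 r) + E ^ 4 * (x2 r * x2 r)
    + 2 * (x0 r * x1 r) + 2 * (x0 r * x2 r) + 2 * E\<^sup>2 * (x1 r * x2 r) + (E - 1) * (\<sigma> r * \<sigma> r * Q r)" for r
  note P = add[OF add[OF add[OF add[OF add[OF add[OF mult[OF x0 x0]
      mult[OF const[of E] mult[OF x1 x1]]] mult[OF const[of "E ^ 4"] mult[OF x2 x2]]]
      mult[OF const[of 2] mult[OF x0 x1]]] mult[OF const[of 2] mult[OF x0 x2]]]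
      mult[OF const[of "2 * E\<^sup>2"] mult[OF x1 x2]]] mult[OF const[of "E - 1"] mult[OF \<sigma>\<sigma> Q]],
      folded P_def]
  show ?thesis
    by (rule second_order_eqI[OF mult[OF second_order_quadratic[of 1 2 E] P]])
      (simp_all add: P_def x0_def x1_def x2_def \<sigma>_def Q_def value3_def scal_def Let_def divide_inverse
        power2_eq_square power3_eq_cube power4_eq_xxxx algebra_simps)
qed

text \<open>In terms of the mass q, the constant and linear terms cancel, while a coefficient g of
  q^2 leaves g q(r) (q(r) - q(2r)), which is about -g r^2. The limit is thus -g, and its positivity
  puts the intermediate value above the chord.\<close>

lemma value3_second_difference:
  defines "G \<equiv> \<lambda>r. value3 r (weight r * (2 - E) - 1) (1 + weight r * (E - 3)) (weight r)"
  shows "((\<lambda>r. (G r - (1 - weight r / weight (2 * r)) * G 0 - weight r / weight (2 * r) * G (2 * r)) / r\<^sup>2)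
    \<longlongrightarrow> E * (E - 1) ^ 3) (at_right 0)"
proof -
  define t where "t r = weight r / weight (2 * r)" for r
  have G0: "G 0 = E - 1"
    by (simp add: G_def weight_def value3_def scal_def)
  have G: "second_order G (E - 1) (2 - 4 * E + 2 * E\<^sup>2) (5 * E ^ 3 - 4 + 11 * E - 11 * E\<^sup>2 - E ^ 4)"
    unfolding G_def by (rule second_order_value3)
  have t: "second_order t (1 / 2) (1 - E / 2) (E\<^sup>2 + E / 2 - 2)"
    unfolding t_def[abs_def] by (rule second_order_weight_ratio)
  note const = second_order_const and add = second_order_add and mult = second_order_mult
  have "second_order (\<lambda>r. G r - (1 - t r) * G 0 - t r * G (2 * r)) 0 0 (E * (E - 1) ^ 3)"
    by (rule second_order_eqI[OF add[OF add[OF G const[of "1 - E"]]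
            mult[OF t add[OF const[of "E - 1"] mult[OF const[of "- 1"] second_order_double[OF G]]]]]])
      (simp_all add: G0 power2_eq_square power3_eq_cube power4_eq_xxxx algebra_simps)
  then show ?thesis
    by (simp add: second_order_def t_def)
qed

lemma weight_ratio:
  assumes "r > 0"
  shows "0 \<le> weight r / weight (2 * r)" "weight r / weight (2 * r) \<le> 1" "weight (2 * r) > 0"
proof -
  have S: "scal r > 0" "scal (2 * r) > 0"
    using assms by (auto intro: scal_pos)
  show pos: "weight (2 * r) > 0"
    using assms S E_gt_1 by (auto simp: weight_def add_pos_pos)
  show "0 \<le> weight r / weight (2 * r)"
    using weight_bounds(1)[of r] pos assms by simp
  \<comment> \<open>The inequality \<open>weight r \<le> weight (2 * r)\<close> with denominators
    cleared and a factor \<open>r\<close> removed.\<close>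
  have "scal r * (2 * (1 + E * (2 * r))) - (1 + E * r) * scal (2 * r)
      = 1 + 3 * (E * r) + 2 * (E * r\<^sup>2)"
    by (simp add: scal_def algebra_simps power2_eq_square)
  also have "\<dots> \<ge> 0" using assms E_gt_1 by simp
  finally have "r * ((1 + E * r) * scal (2 * r)) \<le> r * (scal r * (2 * (1 + E * (2 * r))))"
    using assms by (intro mult_left_mono) auto
  then have "weight r \<le> weight (2 * r)"
    using S by (simp add: weight_def divide_simps mult_ac)
  then show "weight r / weight (2 * r) \<le> 1"
    using pos by simp
qed

section \<open>Failure of joint convexity\<close>

lemma not_jointly_convex:
  "\<not> jointly_convex (prob_measures X) (C1_dual0 X) (metric_tensor \<epsilon> sq_cost X)"
proof
  assume convex: "jointly_convex (prob_measures X) (C1_dual0 X) (metric_tensor \<epsilon> sq_cost X)"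
  define G where "G r = value3 r (weight r * (2 - E) - 1) (1 + weight r * (E - 3)) (weight r)" for r
  have "E * (E - 1) ^ 3 > 0" using E_gt_1 by simp
  then have "\<forall>\<^sub>F r in at_right 0. (G r - (1 - weight r / weight (2 * r)) * G 0
      - weight r / weight (2 * r) * G (2 * r)) / r\<^sup>2 > 0"
    using order_tendstoD(1)[OF value3_second_difference] by (simp add: G_def)
  then have "\<forall>\<^sub>F r in at_right 0. r > 0 \<and> (G r - (1 - weight r / weight (2 * r)) * G 0
      - weight r / weight (2 * r) * G (2 * r)) / r\<^sup>2 > 0"
    using eventually_at_right_less eventually_conj by blast
  then obtain r :: real where r: "r > 0" and
    neg: "(G r - (1 - weight r / weight (2 * r)) * G 0 - weight r / weight (2 * r) * G (2 * r)) / r\<^sup>2 > 0"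
    using eventually_happens'[OF trivial_limit_at_right_real[of 0]] by blast
  \<comment> \<open>The mixing parameter for which the mixture of the masses at parameters 0 and
    \<open>2 * r\<close> is exactly the mass at \<open>r\<close>.\<close>
  define t where "t = weight r / weight (2 * r)"
  have t: "0 \<le> t" "t \<le> 1" and t_weight: "t * weight (2 * r) = weight r"
    using weight_ratio[OF r] by (auto simp: t_def)
  have less: "(1 - t) * G 0 + t * G (2 * r) < G r"
    using neg r by (simp add: t_def[symmetric] zero_less_divide_iff)
  define \<nu> where "\<nu> r = eval3 (weight r * (2 - E) - 1) (1 + weight r * (E - 3)) (weight r)" for r
  have \<nu>: "\<nu> s \<in> C1_dual0 X" for s
    unfolding \<nu>_def by (rule eval3_C1_dual0) (simp add: algebra_simps)
  have metric: "metric_tensor \<epsilon> sq_cost X (dirac_mix (weight s)) (\<nu> s) = \<epsilon> / 2 * G s" if "s \<ge> 0" for s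
    unfolding \<nu>_def G_def using that by (rule metric_tensor_dirac_mix) (simp add: algebra_simps)
  have w0: "weight 0 = 0" by (simp add: weight_def)
  have "measure_mix t (dirac_mix (weight 0)) (dirac_mix (weight (2 * r))) = dirac_mix (weight r)"
    using measure_mix_dirac_mix[of 0 "weight (2 * r)" t] weight_bounds[of "2 * r"] r t
    by (simp add: w0 t_weight)
  \<comment> \<open>The coefficients of \<open>\<nu>\<close> are affine in the weight, so the same
    \<open>t\<close> mixes the functionals correctly.\<close>
  moreover have "(\<lambda>\<phi>. (1 - t) * \<nu> 0 \<phi> + t * \<nu> (2 * r) \<phi>) = \<nu> r"
    by (simp add: fun_eq_iff \<nu>_def eval3_def w0 t_weight[symmetric] algebra_simps)
  ultimately have "metric_tensor \<epsilon> sq_cost X (dirac_mix (weight r)) (\<nu> r)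
      \<le> (1 - t) * metric_tensor \<epsilon> sq_cost X (dirac_mix (weight 0)) (\<nu> 0)
        + t * metric_tensor \<epsilon> sq_cost X (dirac_mix (weight (2 * r))) (\<nu> (2 * r))"
    using convex[unfolded jointly_convex_def, rule_format,
        OF dirac_mix_prob[of "weight 0"] dirac_mix_prob[of "weight (2 * r)"] \<nu>[of 0] \<nu>[of "2 * r"], of t] t
    by simp
  then have "\<epsilon> / 2 * G r \<le> (1 - t) * (\<epsilon> / 2 * G 0) + t * (\<epsilon> / 2 * G (2 * r))"
    using r by (simp only: metric order_refl less_imp_le mult_pos_pos zero_less_numeral)
  then have "\<epsilon> / 2 * G r \<le> \<epsilon> / 2 * ((1 - t) * G 0 + t * G (2 * r))"
    by (simp only: algebra_simps)
  then have "G r \<le> (1 - t) * G 0 + t * G (2 * r)"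
    using eps_pos by (simp only: mult_le_cancel_left_pos half_gt_zero)
  then show False using less by simp
qed

end

theorem corollary7p6:
  fixes \<epsilon> :: real and c :: "real \<Rightarrow> real \<Rightarrow> real" and U X :: "real set"
  assumes "\<epsilon> > 0"
    and "c = (\<lambda>x y. \<bar>x - y\<bar>\<^sup>2)"
    and "open U" and "bounded U" and "X = closure U"
    and "diameter X > sqrt (2 * \<epsilon>)"
  shows "\<not> jointly_convex (prob_measures X) (C1_dual0 X) (metric_tensor \<epsilon> c X)"
proof -
  \<comment> \<open>Otherwise the diameter would be 0, below
    \<open>sqrt (2 * \<epsilon>)\<close>.\<close>
  have "U \<noteq> {}"
    using assms(1,5,6) by (auto simp: diameter_def)
  then obtain a where "a \<in> U" by blast
  then obtain e where e: "e > 0" "cball a e \<subseteq> U"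
    using \<open>open U\<close> open_contains_cball by blast
  have sub: "U \<subseteq> X" using \<open>X = closure U\<close> closure_subset by blast
  \<comment> \<open>Spacing \<open>e / 2\<close> places the third point at \<open>a + e\<close>,
    still in the closed ball.\<close>
  interpret three_points \<epsilon> a "e / 2" X
  proof
    show "compact X" using \<open>bounded U\<close> \<open>X = closure U\<close> by simp
    show "a \<in> X" "a + e / 2 \<in> X" "a + 2 * (e / 2) \<in> X"
      using e sub by (auto simp: subset_iff dist_real_def)
  qed (use \<open>\<epsilon> > 0\<close> e in auto)
  show ?thesis
    using not_jointly_convex unfolding sq_cost_def assms(2) .
qed

end
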